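(* Consider a multitype Galton--Watson branching process with countable typeset $\mathcal X$ and a family $\mathcal A=\{A_i\}_{i\in K_{\mathcal A}}$ of subsets of $\mathcal X$. If $\mathcal A$ satisfies (C3), i.e. there are no $i\ne j$ in $K_{\mathcal A}$ with $A_i\Leftrightarrow A_j$, then the map $f_{\mathcal A}:\mathfrak P_{\mathcal A}\to2^{K_{\mathcal A}}/_\sim$, $f_{\mathcal A}(I)=[I]_\sim$, is injective; in particular $|\mathfrak P_{\mathcal A}|\le|2^{K_{\mathcal A}}/_\sim|$.
   Context: A multitype Galton--Watson branching process (MGWBP) $\{\boldsymbol Z_n\}_{n\ge0}$ with countable (finite or countably infinite) typeset $\mathcal X$: $\boldsymbol Z_n=(Z_{n,x})_{x\in\mathcal X}$, where $Z_{n,x}$ is the number of type-$x$ individuals in generation $n$; each individual lives for one generation and at death, independently of all others, gives birth to a finite random number of offspring of various types, with a joint law depending only on its type. $\mathbb P_x$ denotes the law of the process started from a single type-$x$ individual. For $A\subseteq\mathcal X$, $\mathcal E(A)$ is the event $\lim_{n\to\infty}\sum_{x\in A}Z_{n,x}=0$ and $\mathcal S(A)=\mathcal E(A)^c$. For $A,B\subseteq\mathcal X$: $A\Rightarrow B$ means $\mathbb P_x(\mathcal S(A)\cap\mathcal E(B))=0$ for all $x\in\mathcal X$; $A\nRightarrow B$ is its negation; $A\Leftrightarrow B$ means $A\Rightarrow B$ and $B\Rightarrow A$; $A\nLeftrightarrow B$ means $A\nRightarrow B$ and $B\nRightarrow A$. $\mathcal A=\{A_i\}_{i\in K_{\mathcal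 A}}$, $A_i\subseteq\mathcal X$, $K_{\mathcal A}=\{1,\dots,\kappa_{\mathcal A}\}$, $\kappa_{\mathcal A}\le\infty$ (if $\kappa_{\mathcal A}=\infty$, $K_{\mathcal A}=\{1,2,3,\dots\}$). Equivalence relation on $2^{K_{\mathcal A}}$: $I\sim J$ iff for every $i\in I$ there exists $j\in J$ with $A_i\Rightarrow A_j$, and for every $j\in J$ there exists $i\in I$ with $A_j\Rightarrow A_i$; $[I]_\sim$ is the class of $I$. $I\subseteq K_{\mathcal A}$ is primitive if $A_i\nLeftrightarrow A_j$ for all $i\ne j$ in $I$; $\mathfrak P_{\mathcal A}$ is the set of primitive subsets of $K_{\mathcal A}$. *)

theory Defs
  imports "HOL-Probability.Probability" "HOL-Library.Equipollence" "HOL-Library.Extended_Nat"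
begin

text \<open>
  The typeset is a type \<open>'x\<close> of class \<open>countable\<close>, that is, finite or countably infinite.
  A generation is always a finite population, so the vector \<open>(Z\<^sub>n\<^sub>,\<^sub>x)\<^sub>x\<close> is represented by the
  finite multiset of the types of its individuals, and \<open>Z\<^sub>n\<^sub>,\<^sub>x\<close> is \<open>count (z n) x\<close>.
  The process is specified by its offspring laws \<open>p\<close>: an individual of type \<open>y\<close> has a random
  finite multiset of children with distribution \<open>p y\<close>.
\<close>

text \<open>
  The independent offspring variables; coordinate \<open>(n, y, k)\<close> is the offspring of the \<open>k\<close>-th
  individual of type \<open>y\<close> in generation \<open>n\<close>, should there be one.
\<close>

definition offspring_space ::
    "('x::countable \<Rightarrow> 'x multiset pmf) \<Rightarrow> (nat \<times> 'x \<times> nat \<Rightarrow> 'x multiset) measure" where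
  "offspring_space p = (\<Pi>\<^sub>M (n, y, k)\<in>UNIV. measure_pmf (p y))"

primrec generation ::
    "'x \<Rightarrow> nat \<Rightarrow> (nat \<times> 'x \<times> nat \<Rightarrow> 'x multiset) \<Rightarrow> 'x multiset" where
  "generation x 0 \<omega> = {#x#}"
| "generation x (Suc n) \<omega> =
     (\<Sum>y\<in>set_mset (generation x n \<omega>). \<Sum>k<count (generation x n \<omega>) y. \<omega> (n, y, k))"

text \<open>
  \<open>mgwbp_law p x\<close> is the law \<open>\<P>\<^sub>x\<close>, as a measure on the space of paths \<open>(z n)\<^sub>n\<close>.
\<close>

definition mgwbp_law ::
    "('x::countable \<Rightarrow> 'x multiset pmf) \<Rightarrow> 'x \<Rightarrow> (nat \<Rightarrow> 'x multiset) measure" where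
  "mgwbp_law p x =
     distr (offspring_space p) (\<Pi>\<^sub>M n\<in>UNIV. count_space UNIV) (\<lambda>\<omega> n. generation x n \<omega>)"

text \<open>
  The sum over a possibly infinite \<open>A\<close> has only finitely many nonzero terms;
  see \<open>infsum_count_eq_size\<close> below.
\<close>

definition extinction :: "'x set \<Rightarrow> (nat \<Rightarrow> 'x multiset) set" where
  "extinction A = {z. (\<lambda>n. \<Sum>\<^sub>\<infinity>y\<in>A. real (count (z n) y)) \<longlonglongrightarrow> 0}"

definition survival :: "'x set \<Rightarrow> (nat \<Rightarrow> 'x multiset) set" where
  "survival A = - extinction A"

definition surv_imp :: "('x::countable \<Rightarrow> 'x multiset pmf) \<Rightarrow> 'x set \<Rightarrow> 'x set \<Rightarrow> bool" where
  "surv_imp p A B \<longleftrightarrow> (\<forall>x. measure (mgwbp_law p x) (survival A \<inter> extinction B) = 0)"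

definition surv_iff :: "('x::countable \<Rightarrow> 'x multiset pmf) \<Rightarrow> 'x set \<Rightarrow> 'x set \<Rightarrow> bool" where
  "surv_iff p A B \<longleftrightarrow> surv_imp p A B \<and> surv_imp p B A"

text \<open>
  Following the convention for the struck-out double arrow, this is incomparability (both
  implications fail), which is stronger than the negation \<open>\<not> surv_iff p A B\<close>.
\<close>

definition surv_incomparable ::
    "('x::countable \<Rightarrow> 'x multiset pmf) \<Rightarrow> 'x set \<Rightarrow> 'x set \<Rightarrow> bool" where
  "surv_incomparable p A B \<longleftrightarrow> \<not> surv_imp p A B \<and> \<not> surv_imp p B A"

definition index_set :: "enat \<Rightarrow> nat set" where
  "index_set \<kappa> = {i. 1 \<le> i \<and> enat i \<le> \<kappa>}"

definition index_equiv ::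
    "('x::countable \<Rightarrow> 'x multiset pmf) \<Rightarrow> enat \<Rightarrow> (nat \<Rightarrow> 'x set) \<Rightarrow> nat set rel" where
  "index_equiv p \<kappa> A = {(I, J). I \<subseteq> index_set \<kappa> \<and> J \<subseteq> index_set \<kappa> \<and>
     (\<forall>i\<in>I. \<exists>j\<in>J. surv_imp p (A i) (A j)) \<and> (\<forall>j\<in>J. \<exists>i\<in>I. surv_imp p (A j) (A i))}"

definition primitive_sets ::
    "('x::countable \<Rightarrow> 'x multiset pmf) \<Rightarrow> enat \<Rightarrow> (nat \<Rightarrow> 'x set) \<Rightarrow> nat set set" where
  "primitive_sets p \<kappa> A =
     {I. I \<subseteq> index_set \<kappa> \<and> (\<forall>i\<in>I. \<forall>j\<in>I. i \<noteq> j \<longrightarrow> surv_incomparable p (A i) (A j))}"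

definition class_map ::
    "('x::countable \<Rightarrow> 'x multiset pmf) \<Rightarrow> enat \<Rightarrow> (nat \<Rightarrow> 'x set) \<Rightarrow> nat set \<Rightarrow> nat set set" where
  "class_map p \<kappa> A I = index_equiv p \<kappa> A `` {I}"

subsection \<open>Well-definedness of the notions above\<close>

lemma infsum_count_eq_size:
  "(\<Sum>\<^sub>\<infinity>y\<in>A. real (count M y)) = real (size (filter_mset (\<lambda>y. y \<in> A) M))"
proof -
  have "(\<Sum>\<^sub>\<infinity>y\<in>A. real (count M y)) = (\<Sum>\<^sub>\<infinity>y\<in>set_mset M \<inter> A. real (count M y))"
    by (rule infsum_cong_neutral) (auto simp: not_in_iff)
  also have "\<dots> = real (\<Sum>y\<in>set_mset M \<inter> A. count M y)"
    by simp
  also have "(\<Sum>y\<in>set_mset M \<inter> A. count M y) = size (filter_mset (\<lambda>y. y \<in> A) M)"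
    unfolding size_multiset_overloaded_eq by (rule sum.cong) auto
  finally show ?thesis .
qed

lemma countable_multisets: "countable (UNIV :: 'x::countable multiset set)"
proof -
  have "(UNIV :: 'x multiset set) = range mset"
    by (metis ex_mset surj_def)
  then show ?thesis
    by (metis countableI_type countable_image)
qed

lemma measurable_sum_multiset:
  fixes f :: "'i \<Rightarrow> 'w \<Rightarrow> 'x::countable multiset"
  assumes "finite S" "\<And>i. i \<in> S \<Longrightarrow> f i \<in> M \<rightarrow>\<^sub>M count_space UNIV"
  shows "(\<lambda>\<omega>. \<Sum>i\<in>S. f i \<omega>) \<in> M \<rightarrow>\<^sub>M count_space UNIV"
  using assms
proof (induction S rule: finite_induct)
  case empty
  then show ?case by simp
next
  case (insert i S)
  have 1: "f i \<in> M \<rightarrow>\<^sub>M count_space UNIV"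
    and 2: "(\<lambda>\<omega>. \<Sum>i\<in>S. f i \<omega>) \<in> M \<rightarrow>\<^sub>M count_space UNIV"
    using insert by auto
  have "(\<lambda>\<omega>. a + (\<Sum>i\<in>S. f i \<omega>)) \<in> M \<rightarrow>\<^sub>M count_space UNIV" for a
    using measurable_compose[OF 2, of "\<lambda>b. a + b" "count_space UNIV"] by simp
  from measurable_compose_countable'[OF this 1 countable_multisets]
  show ?case using insert by simp
qed

lemma measurable_generation:
  "generation x n \<in> offspring_space p \<rightarrow>\<^sub>M count_space UNIV"
proof (induction n)
  case 0
  then show ?case by simp
next
  case (Suc n)
  have coord: "(\<lambda>\<omega>. \<omega> (n, y, k)) \<in> offspring_space p \<rightarrow>\<^sub>M count_space UNIV" for y k
  proof -
    have "(\<lambda>\<omega>. \<omega> (n, y, k)) \<in> offspring_space p \<rightarrow>\<^sub>M measure_pmf (p y)"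
      unfolding offspring_space_def
      using measurable_component_singleton[of "(n, y, k)" UNIV "\<lambda>(n, y, k). measure_pmf (p y)"]
      by simp
    then show ?thesis
      by (simp cong: measurable_cong_sets)
  qed
  have "(\<lambda>\<omega>. \<Sum>y\<in>set_mset M. \<Sum>k<count M y. \<omega> (n, y, k))
      \<in> offspring_space p \<rightarrow>\<^sub>M count_space UNIV" for M
    by (intro measurable_sum_multiset coord) auto
  from measurable_compose_countable'[OF this Suc countable_multisets]
  show ?case by simp
qed

lemma measurable_path:
  "(\<lambda>\<omega> n. generation x n \<omega>) \<in> offspring_space p \<rightarrow>\<^sub>M (\<Pi>\<^sub>M n\<in>UNIV. count_space UNIV)"
  by (rule measurable_PiM_single') (auto intro: measurable_generation)

lemma prob_space_mgwbp_law: "prob_space (mgwbp_law p x)"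
proof -
  have "prob_space (offspring_space p)"
    unfolding offspring_space_def
    by (rule prob_space_PiM) (auto simp: prob_space_measure_pmf split: prod.splits)
  then show ?thesis
    unfolding mgwbp_law_def by (rule prob_space.prob_space_distr) (rule measurable_path)
qed

lemma space_mgwbp_law: "space (mgwbp_law p x) = UNIV"
  by (simp add: mgwbp_law_def space_PiM PiE_UNIV_domain)

lemma sets_extinction: "extinction A \<in> sets (mgwbp_law p x)"
proof -
  let ?N = "mgwbp_law p x"
  have coord: "(\<lambda>z. z n) \<in> ?N \<rightarrow>\<^sub>M count_space UNIV" for n
    unfolding mgwbp_law_def by simp
  have [measurable]: "(\<lambda>z. \<Sum>\<^sub>\<infinity>y\<in>A. real (count (z n) y)) \<in> borel_measurable ?N" for n
    by (rule measurable_compose[OF coord]) simp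
  have "{z \<in> space ?N. (\<lambda>n. \<Sum>\<^sub>\<infinity>y\<in>A. real (count (z n) y)) \<longlonglongrightarrow> 0} \<in> sets ?N"
    by measurable
  then show ?thesis
    by (simp add: extinction_def space_mgwbp_law)
qed

lemma sets_survival: "survival A \<in> sets (mgwbp_law p x)"
  using sets.compl_sets[OF sets_extinction[of A p x]]
  by (simp add: survival_def space_mgwbp_law Compl_eq_Diff_UNIV)

lemma surv_imp_refl: "surv_imp p A A"
  by (simp add: surv_imp_def survival_def)

lemma surv_imp_trans:
  assumes "surv_imp p A B" "surv_imp p B C"
  shows "surv_imp p A C"
  unfolding surv_imp_def
proof
  fix x
  interpret prob_space "mgwbp_law p x" by (rule prob_space_mgwbp_law)
  note [intro] = sets.Int sets.Un sets_extinction sets_survival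
  have "prob (survival A \<inter> extinction C)
      \<le> prob ((survival A \<inter> extinction B) \<union> (survival B \<inter> extinction C))"
  proof (rule finite_measure_mono)
    show "survival A \<inter> extinction C
        \<subseteq> (survival A \<inter> extinction B) \<union> (survival B \<inter> extinction C)"
      by (auto simp: survival_def)
  qed blast
  also have "\<dots> \<le> prob (survival A \<inter> extinction B) + prob (survival B \<inter> extinction C)"
    by (rule measure_Un_le) auto
  also have "\<dots> = 0"
    using assms by (simp add: surv_imp_def)
  finally show "prob (survival A \<inter> extinction C) = 0"
    by (simp add: measure_le_0_iff)
qed

lemma equiv_index_equiv: "equiv (Pow (index_set \<kappa>)) (index_equiv p \<kappa> A)"
proof (rule equivI)
  show "index_equiv p \<kappa> A \<subseteq> Pow (index_set \<kappa>) \<times> Pow (index_set \<kappa>)"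
    by (auto simp: index_equiv_def)
  show "refl_on (Pow (index_set \<kappa>)) (index_equiv p \<kappa> A)"
    by (auto simp: refl_on_def index_equiv_def intro: surv_imp_refl)
  show "sym (index_equiv p \<kappa> A)"
    by (auto simp: sym_def index_equiv_def)
  show "trans (index_equiv p \<kappa> A)"
    unfolding trans_def index_equiv_def by (clarsimp; meson surv_imp_trans)
qed

end

theory Submission
  imports Defs
begin

text \<open>Two equivalent primitive sets contain each other. For \<open>i\<close> in
  \<open>I\<close>, the equivalence gives \<open>j\<close> in \<open>J\<close> with
  \<open>A i\<close> implying \<open>A j\<close> in the sense of \<open>surv_imp\<close>, and going
  back gives \<open>i'\<close> in \<open>I\<close> with \<open>A j\<close> implying
  \<open>A i'\<close>. Transitivity and primitivity of \<open>I\<close> collapse this round trip to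
  \<open>i' = i\<close>, so \<open>A i\<close> and \<open>A j\<close> imply each other and (C3)
  yields \<open>i = j\<close>. Hence \<open>I\<close> lies in \<open>J\<close>
  (\<open>primitive_sets_subset_if_equiv\<close>); symmetry of the equivalence gives the other
  inclusion.\<close>

lemma primitive_sets_subset_if_equiv:
  assumes C3: "\<not> (\<exists>i\<in>index_set \<kappa>. \<exists>j\<in>index_set \<kappa>. i \<noteq> j \<and> surv_iff p (A i) (A j))"
    and I: "I \<in> primitive_sets p \<kappa> A"
    and IJ: "(I, J) \<in> index_equiv p \<kappa> A"
  shows "I \<subseteq> J"
proof
  fix i assume i: "i \<in> I"
  with IJ obtain j where j: "j \<in> J" and ij: "surv_imp p (A i) (A j)"
    unfolding index_equiv_def by blast
  from IJ j obtain i' where i': "i' \<in> I" and ji': "surv_imp p (A j) (A i')"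
    unfolding index_equiv_def by blast
  have "surv_imp p (A i) (A i')"
    using ij ji' by (rule surv_imp_trans)
  \<comment> \<open>Distinct members of \<open>I\<close> are incomparable, so an implication in one
    direction already forces equality; mere non-equivalence of distinct members would not suffice
    here.\<close>
  with I i i' have "i' = i"
    unfolding primitive_sets_def surv_incomparable_def by blast
  with ij ji' have "surv_iff p (A i) (A j)"
    by (simp add: surv_iff_def)
  moreover have "i \<in> index_set \<kappa>" "j \<in> index_set \<kappa>"
    using IJ i j by (auto simp: index_equiv_def)
  ultimately have "i = j"
    using C3 by blast
  with j show "i \<in> J" by simp
qed

theorem lemma2:
  fixes p :: "'x::countable \<Rightarrow> 'x multiset pmf"
    and \<kappa> :: enat
    and A :: "nat \<Rightarrow> 'x set"
  assumes C3: "\<not> (\<exists>i\<in>index_set \<kappa>. \<exists>j\<in>index_set \<kappa>. i \<noteq> j \<and> surv_iff p (A i) (A j))"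
  shows "class_map p \<kappa> A \<in> primitive_sets p \<kappa> A \<rightarrow> Pow (index_set \<kappa>) // index_equiv p \<kappa> A
    \<and> inj_on (class_map p \<kappa> A) (primitive_sets p \<kappa> A)
    \<and> primitive_sets p \<kappa> A \<lesssim> Pow (index_set \<kappa>) // index_equiv p \<kappa> A"
proof -
  have sub: "I \<in> Pow (index_set \<kappa>)" if "I \<in> primitive_sets p \<kappa> A" for I
    using that by (auto simp: primitive_sets_def)
  have map: "class_map p \<kappa> A \<in> primitive_sets p \<kappa> A \<rightarrow> Pow (index_set \<kappa>) // index_equiv p \<kappa> A"
    unfolding class_map_def by (intro funcsetI quotientI sub)
  have inj: "inj_on (class_map p \<kappa> A) (primitive_sets p \<kappa> A)"
  proof (rule inj_onI)
    fix I J
    assume I: "I \<in> primitive_sets p \<kappa> A" and J: "J \<in> primitive_sets p \<kappa> A"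
      and eq: "class_map p \<kappa> A I = class_map p \<kappa> A J"
    \<comment> \<open>\<open>J\<close> belongs to its own class by reflexivity, hence to the class
      of \<open>I\<close>.\<close>
    have IJ: "(I, J) \<in> index_equiv p \<kappa> A"
      using eq eq_equiv_class[OF _ equiv_index_equiv sub[OF J]] by (simp add: class_map_def)
    then have JI: "(J, I) \<in> index_equiv p \<kappa> A"
      using equiv_index_equiv by (meson equivE symD)
    from primitive_sets_subset_if_equiv[OF C3 I IJ] primitive_sets_subset_if_equiv[OF C3 J JI]
    show "I = J" by (rule subset_antisym)
  qed
  \<comment> \<open>The cardinal inequality, meaningful for infinite sets too, asks for an
    injection; \<open>class_map p \<kappa> A\<close> is one.\<close>
  have "primitive_sets p \<kappa> A \<lesssim> Pow (index_set \<kappa>) // index_equiv p \<kappa> A"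
    using map inj unfolding lepoll_def by blast
  with map inj show ?thesis by blast
qed

end
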